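(* Let $H$ be a real Hilbert space and let $W_1,W_2\subset H$ be closed subspaces. Let $P_i$ denote the orthogonal projection onto $W_i$, $i=1,2$. Suppose that $W_1$ and $W_2$ enclose a positive angle, i.e., $c_0(W_1,W_2)<1$. Then the operator $$R_1:=\begin{pmatrix}\mathrm{Id}&P_1\\P_2&\mathrm{Id}\end{pmatrix}\in\mathcal{L}(H^2,H^2)$$ is continuously invertible with $\|R_1^{-1}\|_{\mathcal{L}(H^2,H^2)}\le 4/(1-c_0(W_1,W_2))$, the subspace $W_1+W_2$ is closed, and the orthogonal projection $P$ onto $W_1+W_2$ is given by $$P=\begin{pmatrix}\mathrm{Id}&\mathrm{Id}\end{pmatrix}R_1^{-1}\begin{pmatrix}P_1\\P_2\end{pmatrix}.$$
   Context: $B_H:=\{x\in H\mid\|x\|_H\le1\}$. The cosine of the minimal angle between $W_1$ and $W_2$ is $c_0(W_1,W_2):=\sup\{(x_1,x_2)_H\mid x_1\in W_1\cap B_H,\ x_2\in W_2\cap B_H\}\in[0,1]$. $H^2=H\times H$ carries its canonical Hilbert space norm, and $\mathcal{L}(X,Y)$ denotes the space of continuous linear operators with the operator norm. *)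

theory Defs
  imports "HOL-Analysis.Analysis"
begin

text \<open>A real Hilbert space is a type of sort \<open>{real_inner, complete_space}\<close>; the product type
  \<open>'a \<times> 'a\<close> carries the Hilbert space norm \<open>norm (x, y) = sqrt ((norm x)\<^sup>2 + (norm y)\<^sup>2)\<close>.\<close>

definition is_orthogonal_projection ::
    "'a::real_inner set \<Rightarrow> ('a \<Rightarrow>\<^sub>L 'a) \<Rightarrow> bool" where
  "is_orthogonal_projection W P \<longleftrightarrow> (\<forall>x. P x \<in> W \<and> x - P x \<in> W\<^sup>\<bottom>)"

text \<open>For a closed subspace of a Hilbert space the description is proper; see
  \<open>ex1_orthogonal_projection\<close> below.\<close>

definition orthogonal_projection :: "'a::real_inner set \<Rightarrow> 'a \<Rightarrow>\<^sub>L 'a" where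
  "orthogonal_projection W = (THE P. is_orthogonal_projection W P)"

definition cos_min_angle :: "'a::real_inner set \<Rightarrow> 'a set \<Rightarrow> real" where
  "cos_min_angle W\<^sub>1 W\<^sub>2 =
     Sup {inner x\<^sub>1 x\<^sub>2 | x\<^sub>1 x\<^sub>2. x\<^sub>1 \<in> W\<^sub>1 \<inter> cball 0 1 \<and> x\<^sub>2 \<in> W\<^sub>2 \<inter> cball 0 1}"

lift_definition blinfun_row ::
    "('a::real_normed_vector \<Rightarrow>\<^sub>L 'c::real_normed_vector) \<Rightarrow> ('b::real_normed_vector \<Rightarrow>\<^sub>L 'c)
      \<Rightarrow> ('a \<times> 'b) \<Rightarrow>\<^sub>L 'c"
  is "\<lambda>A B (x, y). A x + B y"
  unfolding case_prod_unfold
  by (intro bounded_linear_add bounded_linear_compose[OF _ bounded_linear_fst]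
      bounded_linear_compose[OF _ bounded_linear_snd])

lift_definition blinfun_column ::
    "('a::real_normed_vector \<Rightarrow>\<^sub>L 'b::real_normed_vector) \<Rightarrow> ('a \<Rightarrow>\<^sub>L 'c::real_normed_vector)
      \<Rightarrow> 'a \<Rightarrow>\<^sub>L ('b \<times> 'c)"
  is "\<lambda>A B x. (A x, B x)"
  by (rule bounded_linear_Pair)

definition R1_operator :: "'a::real_inner set \<Rightarrow> 'a set \<Rightarrow> ('a \<times> 'a) \<Rightarrow>\<^sub>L ('a \<times> 'a)" where
  "R1_operator W\<^sub>1 W\<^sub>2 = blinfun_column
     (blinfun_row id_blinfun (orthogonal_projection W\<^sub>1))
     (blinfun_row (orthogonal_projection W\<^sub>2) id_blinfun)"

lemma bdd_above_cos_min_angle: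
  fixes W\<^sub>1 W\<^sub>2 :: "'a::real_inner set"
  shows "bdd_above {inner x\<^sub>1 x\<^sub>2 | x\<^sub>1 x\<^sub>2. x\<^sub>1 \<in> W\<^sub>1 \<inter> cball 0 1 \<and> x\<^sub>2 \<in> W\<^sub>2 \<inter> cball 0 1}"
proof (rule bdd_aboveI[where M = 1])
  fix r assume "r \<in> {inner x\<^sub>1 x\<^sub>2 | x\<^sub>1 x\<^sub>2. x\<^sub>1 \<in> W\<^sub>1 \<inter> cball 0 1 \<and> x\<^sub>2 \<in> W\<^sub>2 \<inter> cball 0 1}"
  then obtain x y :: 'a where "r = inner x y" "x \<in> cball 0 1" "y \<in> cball 0 1" by blast
  then have r: "r = inner x y" "norm x \<le> 1" "norm y \<le> 1" by simp_all
  have "inner x y \<le> norm x * norm y" by (rule norm_cauchy_schwarz)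
  also have "\<dots> \<le> 1 * 1" using r by (intro mult_mono) auto
  finally show "r \<le> 1" using r by simp
qed

lemma nearest_point_exists:
  fixes W :: "'a::{real_inner, complete_space} set"
  assumes "subspace W" "closed W"
  shows "\<exists>p\<in>W. \<forall>z\<in>W. dist x p \<le> dist x z"
proof -
  define d where "d = infdist x W"
  define r where "r n = d + inverse (real (Suc n))" for n
  define S where "S n = W \<inter> cball x (r n)" for n
  have ne: "W \<noteq> {}" using subspace_0[OF assms(1)] by auto
  have d0: "d \<ge> 0" by (simp add: d_def infdist_nonneg)
  have rlim: "(\<lambda>n. 4 * ((r n)\<^sup>2 - d\<^sup>2)) \<longlonglongrightarrow> 4 * ((d + 0)\<^sup>2 - d\<^sup>2)"
    unfolding r_def by (intro tendsto_intros LIMSEQ_inverse_real_of_nat)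
  have close: "(dist u v)\<^sup>2 \<le> 4 * ((r n)\<^sup>2 - d\<^sup>2)" if "u \<in> S n" "v \<in> S n" for u v n
  proof -
    let ?m = "(1/2) *\<^sub>R (u + v)"
    have "?m \<in> W"
      using that assms(1) by (auto simp: S_def intro!: subspace_scale subspace_add)
    then have "d \<le> norm (x - ?m)" by (metis d_def infdist_le dist_norm)
    then have "d\<^sup>2 \<le> (norm (x - ?m))\<^sup>2" using d0 by (intro power_mono)
    moreover have "(norm (x - u))\<^sup>2 \<le> (r n)\<^sup>2" "(norm (x - v))\<^sup>2 \<le> (r n)\<^sup>2"
      using that by (auto simp: S_def dist_norm intro!: power_mono)
    moreover have "(norm (u - v))\<^sup>2
        = 2 * (norm (x - u))\<^sup>2 + 2 * (norm (x - v))\<^sup>2 - 4 * (norm (x - ?m))\<^sup>2"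
      by (simp add: power2_norm_eq_inner inner_diff_left inner_diff_right inner_add_left
          inner_add_right inner_commute algebra_simps)
    ultimately show ?thesis by (simp add: dist_norm)
  qed
  obtain p where p: "\<And>n. p \<in> S n"
  proof (rule decreasing_closed_nest[of S])
    show "closed (S n)" for n by (auto simp: S_def assms(2))
    show "S n \<noteq> {}" for n
    proof -
      have "Inf (dist x ` W) < r n" using ne by (simp add: r_def d_def infdist_notempty)
      moreover have "dist x ` W \<noteq> {}" using ne by simp
      ultimately have "\<exists>t\<in>dist x ` W. t < r n" by (intro cInf_lessD)
      then obtain a where "a \<in> W" "dist x a < r n" by blast
      then show ?thesis by (auto simp: S_def)
    qed
    show "S n \<subseteq> S m" if "m \<le> n" for m n
    proof -
      have "r n \<le> r m" using that by (simp add: r_def field_simps)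
      then show ?thesis by (auto simp: S_def)
    qed
    show "\<exists>n. \<forall>x\<in>S n. \<forall>y\<in>S n. dist x y < e" if e: "e > 0" for e
    proof -
      have "eventually (\<lambda>n. 4 * ((r n)\<^sup>2 - d\<^sup>2) < e\<^sup>2) sequentially"
        using order_tendstoD(2)[OF rlim, of "e\<^sup>2"] e by simp
      then obtain n where n: "4 * ((r n)\<^sup>2 - d\<^sup>2) < e\<^sup>2" by (auto simp: eventually_sequentially)
      have "dist u v < e" if "u \<in> S n" "v \<in> S n" for u v
      proof (rule power_less_imp_less_base)
        show "(dist u v)\<^sup>2 < e\<^sup>2" using close[OF that] n by linarith
      qed (use e in simp)
      then show ?thesis by blast
    qed
  qed (rule that)
  have "dist x p \<le> d"
  proof (rule LIMSEQ_le_const)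
    show "r \<longlonglongrightarrow> d"
      unfolding r_def using tendsto_add[OF tendsto_const LIMSEQ_inverse_real_of_nat, of d] by simp
    show "\<exists>N. \<forall>n\<ge>N. dist x p \<le> r n" using p by (auto simp: S_def)
  qed
  moreover have "p \<in> W" using p[of 0] by (simp add: S_def)
  moreover have "d \<le> dist x z" if "z \<in> W" for z using infdist_le[OF that] by (simp add: d_def)
  ultimately show ?thesis by (meson order_trans)
qed

lemma orthogonal_decomposition_ex1:
  fixes W :: "'a::{real_inner, complete_space} set"
  assumes W: "subspace W" "closed W"
  shows "\<exists>!p. p \<in> W \<and> x - p \<in> W\<^sup>\<bottom>"
proof (rule ex_ex1I)
  obtain p where p: "p \<in> W" "\<forall>z\<in>W. dist x p \<le> dist x z"
    using nearest_point_exists[OF W] by blast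
  have le: "inner (x - p) w \<le> 0" if "w \<in> W" for w
    using any_closest_point_dot[OF subspace_imp_convex[OF W(1)] W(2) p(1) _ p(2), of "p + w"]
      subspace_add[OF W(1) p(1) that] by simp
  have "inner (x - p) w = 0" if "w \<in> W" for w
    using le[OF that] le[OF subspace_neg[OF W(1) that]] by simp
  then show "\<exists>p. p \<in> W \<and> x - p \<in> W\<^sup>\<bottom>"
    using p(1) by (auto simp: orthogonal_comp_def orthogonal_def inner_commute)
next
  fix p q assume *: "p \<in> W \<and> x - p \<in> W\<^sup>\<bottom>" "q \<in> W \<and> x - q \<in> W\<^sup>\<bottom>"
  then have "p - q \<in> W" using subspace_diff[OF W(1)] by blast
  with * have "inner (p - q) (x - p) = 0" "inner (p - q) (x - q) = 0"
    by (auto simp: orthogonal_comp_def orthogonal_def)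
  then have "inner (p - q) (p - q) = 0" by (simp add: inner_diff_right)
  then show "p = q" by simp
qed

lemma ex1_orthogonal_projection:
  fixes W :: "'a::{real_inner, complete_space} set"
  assumes W: "subspace W" "closed W"
  shows "\<exists>!P. is_orthogonal_projection W P"
proof (rule ex_ex1I)
  define f where "f x = (THE p. p \<in> W \<and> x - p \<in> W\<^sup>\<bottom>)" for x
  have f: "f x \<in> W \<and> x - f x \<in> W\<^sup>\<bottom>" for x
    unfolding f_def by (rule theI'[OF orthogonal_decomposition_ex1[OF W]])
  have feq: "f x = p" if "p \<in> W" "x - p \<in> W\<^sup>\<bottom>" for x p
    using orthogonal_decomposition_ex1[OF W, of x] f[of x] that by blast
  have C: "subspace (W\<^sup>\<bottom>)" by (rule subspace_orthogonal_comp)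
  have "bounded_linear f"
  proof (rule bounded_linear_intro[where K = 1])
    show "f (x + y) = f x + f y" for x y
    proof (rule feq)
      have "x + y - (f x + f y) = (x - f x) + (y - f y)" by simp
      then show "x + y - (f x + f y) \<in> W\<^sup>\<bottom>" using f subspace_add[OF C] by metis
    qed (use f subspace_add[OF W(1)] in blast)
    show "f (c *\<^sub>R x) = c *\<^sub>R f x" for c x
    proof (rule feq)
      have "c *\<^sub>R x - c *\<^sub>R f x = c *\<^sub>R (x - f x)" by (simp add: scaleR_diff_right)
      then show "c *\<^sub>R x - c *\<^sub>R f x \<in> W\<^sup>\<bottom>" using f subspace_scale[OF C] by metis
    qed (use f subspace_scale[OF W(1)] in blast)
    show "norm (f x) \<le> norm x * 1" for x
    proof -
      have "inner (f x) (x - f x) = 0"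
        using f[of x] by (auto simp: orthogonal_comp_def orthogonal_def)
      then have "(norm (f x))\<^sup>2 = inner (f x) x"
        by (simp add: power2_norm_eq_inner inner_diff_right)
      also have "\<dots> \<le> norm (f x) * norm x" by (rule norm_cauchy_schwarz)
      finally show ?thesis by (cases "f x = 0") (auto simp: power2_eq_square)
    qed
  qed
  then have "is_orthogonal_projection W (Blinfun f)"
    using f by (simp add: is_orthogonal_projection_def bounded_linear_Blinfun_apply)
  then show "\<exists>P. is_orthogonal_projection W P" ..
next
  fix P Q assume "is_orthogonal_projection W P" "is_orthogonal_projection W Q"
  then show "P = Q"
    using orthogonal_decomposition_ex1[OF W]
    by (intro blinfun_eqI) (metis is_orthogonal_projection_def)
qed

end

theory Submission
  imports Defs
begin

text \<open>The operator \<open>R\<^sub>1\<close> is \<open>Id + K\<close> with \<open>K (x, y) = (P\<^sub>1 y, P\<^sub>2 x)\<close>. The nonexpansive map \<open>K\<close> takes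
  values in \<open>W\<^sub>1 \<times> W\<^sub>2\<close> and on that subspace it contracts by the factor \<open>c\<^sub>0 < 1\<close>. The ansatz
  \<open>z = w - u\<close> turns \<open>(Id + K) z = w\<close> into the fixed point equation \<open>u = K w - K u\<close> in \<open>W\<^sub>1 \<times> W\<^sub>2\<close>,
  which has a unique solution; it satisfies \<open>norm u \<le> norm w / (1 - c\<^sub>0)\<close>.
  If \<open>R\<^sub>1 (a, b) = (P\<^sub>1 x, P\<^sub>2 x)\<close>, then \<open>a \<in> W\<^sub>1\<close>, \<open>b \<in> W\<^sub>2\<close>, and both \<open>P\<^sub>1\<close> and \<open>P\<^sub>2\<close> annihilate \<open>x - (a + b)\<close>, so \<open>a + b\<close> is the
  projection of \<open>x\<close>. The subspace \<open>W\<^sub>1 + W\<^sub>2\<close> is closed as the set of fixed points of a continuous map.\<close>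

section \<open>Inverting a perturbation of the identity\<close>

lemma ex1_id_plus_subspace_contraction:
  fixes K :: "'b::{real_normed_vector, complete_space} \<Rightarrow>\<^sub>L 'b"
  assumes V: "subspace V" "closed V"
    and K_in: "\<And>z. K z \<in> V"
    and c: "0 \<le> c" "c < 1"
    and contr: "\<And>z. z \<in> V \<Longrightarrow> norm (K z) \<le> c * norm z"
  shows "\<exists>!z. z + K z = w"
proof (rule ex_ex1I)
  have "\<exists>!u\<in>V. K w - K u = u"
  proof (rule Banach_fix)
    show "complete V" using V(2) by (simp add: complete_eq_closed)
    show "V \<noteq> {}" using K_in by blast
    show "(\<lambda>u. K w - K u) ` V \<subseteq> V" using K_in subspace_diff[OF V(1)] by blast
    show "dist (K w - K u) (K w - K v) \<le> c * dist u v" if "u \<in> V" "v \<in> V" for u v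
    proof -
      have "dist (K w - K u) (K w - K v) = norm (K (u - v))"
        by (simp add: dist_norm blinfun.diff_right norm_minus_commute)
      also have "\<dots> \<le> c * norm (u - v)"
        by (rule contr[OF subspace_diff[OF V(1) that]])
      finally show ?thesis by (simp add: dist_norm)
    qed
  qed (use c in auto)
  then obtain u where "K w - K u = u" by blast
  then have "(w - u) + K (w - u) = w" by (simp add: blinfun.diff_right)
  then show "\<exists>z. z + K z = w" ..
next
  fix z z' assume "z + K z = w" "z' + K z' = w"
  \<comment> \<open>The contraction estimate holds on \<open>V\<close> only, but up to sign the
    difference of two solutions is a value of \<open>K\<close>. Hence it lies in \<open>V\<close>,
    where the estimate forces it to vanish.\<close>
  then have eq: "z - z' = K (z' - z)" by (simp add: blinfun.diff_right algebra_simps)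
  then have "z' - z \<in> V" using K_in subspace_neg[OF V(1)] by (metis minus_diff_eq)
  then have "norm (z' - z) \<le> c * norm (z' - z)"
    using contr eq by (metis norm_minus_commute)
  then have "(1 - c) * norm (z' - z) \<le> 0" by (simp add: algebra_simps)
  then show "z = z'" using c by (simp add: mult_le_0_iff)
qed

text \<open>Solving pointwise defines the inverse, and uniqueness of solutions makes it linear. The
  norm bound comes from 1 + 1/(1 - c) \<le> 2/(1 - c).\<close>

lemma id_plus_subspace_contraction_inverse:
  fixes K :: "'b::{real_normed_vector, complete_space} \<Rightarrow>\<^sub>L 'b"
  assumes V: "subspace V" "closed V"
    and K_in: "\<And>z. K z \<in> V"
    and c: "0 \<le> c" "c < 1"
    and contr: "\<And>z. z \<in> V \<Longrightarrow> norm (K z) \<le> c * norm z"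
    and nonexp: "\<And>z. norm (K z) \<le> norm z"
  obtains S :: "'b \<Rightarrow>\<^sub>L 'b"
  where "(id_blinfun + K) o\<^sub>L S = id_blinfun" "S o\<^sub>L (id_blinfun + K) = id_blinfun"
    "norm S \<le> 2 / (1 - c)"
proof -
  define s where "s w = (THE z. z + K z = w)" for w
  note ex1 = ex1_id_plus_subspace_contraction[OF V K_in c contr]
  have s: "s w + K (s w) = w" for w
    unfolding s_def by (rule theI'[OF ex1])
  have s_eq: "s w = z" if "z + K z = w" for z w
    using ex1[of w] s[of w] that by blast
  have bound: "norm (s w) \<le> 2 / (1 - c) * norm w" for w
  proof -
    \<comment> \<open>Applying \<open>K\<close> to the equation for \<open>s w\<close> moves it into
      \<open>V\<close>, so the last term gains the factor \<open>c\<close>. The datum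
      \<open>w\<close> may lie outside \<open>V\<close>, so \<open>K w\<close> is bounded by
      nonexpansiveness.\<close>
    have Ksw: "K (s w) = K w - K (K (s w))"
      using s[of w] by (metis add_diff_cancel_right' blinfun.add_right)
    have "norm (K (s w)) \<le> norm (K w) + norm (K (K (s w)))"
      by (subst Ksw) (rule norm_triangle_ineq4)
    also have "\<dots> \<le> norm w + c * norm (K (s w))"
      by (intro add_mono nonexp contr K_in)
    finally have Ks: "(1 - c) * norm (K (s w)) \<le> norm w" by (simp add: algebra_simps)
    have "norm (s w) = norm (w - K (s w))" using s[of w] by (metis add_diff_cancel_right')
    also have "\<dots> \<le> norm w + norm (K (s w))" by (rule norm_triangle_ineq4)
    finally have "(1 - c) * norm (s w) \<le> (1 - c) * (norm w + norm (K (s w)))"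
      using c by (intro mult_left_mono) auto
    also have "\<dots> \<le> 1 * norm w + norm w"
      unfolding distrib_left using c by (intro add_mono Ks mult_right_mono) auto
    finally show ?thesis using c by (simp add: field_simps)
  qed
  have lin: "bounded_linear s"
  proof (rule bounded_linear_intro)
    show "s (x + y) = s x + s y" for x y
    proof (rule s_eq)
      have "s x + s y + K (s x + s y) = (s x + K (s x)) + (s y + K (s y))"
        by (simp add: blinfun.add_right)
      then show "s x + s y + K (s x + s y) = x + y" by (simp only: s)
    qed
    show "s (r *\<^sub>R x) = r *\<^sub>R s x" for r x
      by (rule s_eq) (simp add: blinfun.scaleR_right s flip: scaleR_add_right)
    show "norm (s x) \<le> norm x * (2 / (1 - c))" for x using bound[of x] by (simp add: mult.commute)
  qed
  note [simp] = bounded_linear_Blinfun_apply[OF lin]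
  show thesis
  proof (rule that)
    show "(id_blinfun + K) o\<^sub>L Blinfun s = id_blinfun"
      by (rule blinfun_eqI) (simp add: blinfun.add_left s)
    show "Blinfun s o\<^sub>L (id_blinfun + K) = id_blinfun"
      by (rule blinfun_eqI) (simp add: blinfun.add_left s_eq[OF refl])
    show "norm (Blinfun s) \<le> 2 / (1 - c)"
      using c bound by (intro norm_blinfun_bound) auto
  qed
qed

section \<open>Orthogonal projections and the minimal angle\<close>

lemma blinfun_row_apply [simp]: "blinfun_row A B z = A (fst z) + B (snd z)"
  by (simp add: blinfun_row.rep_eq case_prod_unfold)

lemma blinfun_column_apply [simp]: "blinfun_column A B x = (A x, B x)"
  by (simp add: blinfun_column.rep_eq)

lemma is_orthogonal_projection_orthogonal_projection:
  fixes W :: "'a::{real_inner, complete_space} set"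
  assumes "subspace W" "closed W"
  shows "is_orthogonal_projection W (orthogonal_projection W)"
  unfolding orthogonal_projection_def
  by (rule theI'[OF ex1_orthogonal_projection[OF assms]])

lemma orthogonal_projection_eqI:
  fixes W :: "'a::{real_inner, complete_space} set"
  assumes "subspace W" "closed W" "is_orthogonal_projection W P"
  shows "orthogonal_projection W = P"
  using ex1_orthogonal_projection[OF assms(1,2)]
    is_orthogonal_projection_orthogonal_projection[OF assms(1,2)] assms(3) by blast

lemma is_orthogonal_projection_inner:
  assumes "is_orthogonal_projection W P" "w \<in> W"
  shows "inner w (P x) = inner w x"
proof -
  have "inner w (x - P x) = 0"
    using assms by (auto simp: is_orthogonal_projection_def orthogonal_comp_def orthogonal_def)
  then show ?thesis by (simp add: inner_diff_right)
qed

lemma is_orthogonal_projection_norm_le: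
  assumes "is_orthogonal_projection W P"
  shows "norm (P x) \<le> norm x"
proof -
  have "P x \<in> W" using assms by (simp add: is_orthogonal_projection_def)
  then have "norm (P x) * norm (P x) = inner (P x) x"
    using is_orthogonal_projection_inner[OF assms] by (metis power2_eq_square dot_square_norm)
  also have "\<dots> \<le> norm (P x) * norm x" by (rule norm_cauchy_schwarz)
  finally show ?thesis by (cases "P x = 0") auto
qed

lemma is_orthogonal_projection_fixes:
  assumes "subspace W" "is_orthogonal_projection W P" "x \<in> W"
  shows "P x = x"
proof -
  have "x - P x \<in> W"
    using assms by (auto simp: is_orthogonal_projection_def intro: subspace_diff)
  moreover have "x - P x \<in> W\<^sup>\<bottom>" using assms(2) by (simp add: is_orthogonal_projection_def)
  ultimately have "inner (x - P x) (x - P x) = 0"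
    by (auto simp: orthogonal_comp_def orthogonal_def)
  then show ?thesis by simp
qed

text \<open>A continuous projection makes \<open>W\<close> its set of fixed points. This gives
  closedness of the sum once a projection onto it has been constructed.\<close>

lemma is_orthogonal_projection_closed:
  assumes "subspace W" "is_orthogonal_projection W P"
  shows "closed W"
proof -
  have "P x \<in> W" for x using assms(2) by (simp add: is_orthogonal_projection_def)
  then have "x \<in> W \<longleftrightarrow> P x = x" for x
    using is_orthogonal_projection_fixes[OF assms] by metis
  then have "W = {x. P x = x}" by blast
  moreover have "closed {x. P x = x}"
    by (intro closed_Collect_eq continuous_intros)
  ultimately show ?thesis by simp
qed

lemma cos_min_angle_nonneg:
  assumes "subspace W\<^sub>1" "subspace W\<^sub>2"
  shows "0 \<le> cos_min_angle W\<^sub>1 W\<^sub>2"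
  unfolding cos_min_angle_def
proof (rule cSup_upper[OF _ bdd_above_cos_min_angle], rule CollectI, intro exI conjI)
  show "0 = inner 0 (0::'a)" by simp
qed (use assms in \<open>auto simp: subspace_0\<close>)

lemma cos_min_angle_commute: "cos_min_angle W\<^sub>1 W\<^sub>2 = cos_min_angle W\<^sub>2 W\<^sub>1"
  unfolding cos_min_angle_def by (rule arg_cong[where f = Sup]) (auto; metis inner_commute)

text \<open>By homogeneity: normalised nonzero vectors are admissible in the supremum.\<close>

lemma inner_le_cos_min_angle:
  assumes "subspace W\<^sub>1" "subspace W\<^sub>2" "x \<in> W\<^sub>1" "y \<in> W\<^sub>2"
  shows "inner x y \<le> cos_min_angle W\<^sub>1 W\<^sub>2 * (norm x * norm y)"
proof (cases "x = 0 \<or> y = 0")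
  case False
  have "inner (x /\<^sub>R norm x) (y /\<^sub>R norm y) \<le> cos_min_angle W\<^sub>1 W\<^sub>2"
    unfolding cos_min_angle_def
  proof (rule cSup_upper[OF _ bdd_above_cos_min_angle], rule CollectI, intro exI conjI)
    show "inner (x /\<^sub>R norm x) (y /\<^sub>R norm y) = inner (x /\<^sub>R norm x) (y /\<^sub>R norm y)" ..
  qed (use assms False in \<open>auto simp: subspace_scale\<close>)
  then show ?thesis using False by (simp add: field_simps)
qed auto

text \<open>Test the angle inequality with the pair \<open>P y\<close>, \<open>y\<close>: its left
  side is the square of \<open>norm (P y)\<close>, and one factor cancels.\<close>

lemma projection_le_cos_min_angle:
  assumes "subspace W\<^sub>1" "subspace W\<^sub>2" "is_orthogonal_projection W\<^sub>1 P" "y \<in> W\<^sub>2"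
  shows "norm (P y) \<le> cos_min_angle W\<^sub>1 W\<^sub>2 * norm y"
proof (cases "P y = 0")
  case True
  then show ?thesis using cos_min_angle_nonneg[OF assms(1,2)] by simp
next
  case False
  have Py: "P y \<in> W\<^sub>1" using assms(3) by (simp add: is_orthogonal_projection_def)
  have "norm (P y) * norm (P y) = inner (P y) y"
    using is_orthogonal_projection_inner[OF assms(3) Py] by (metis power2_eq_square dot_square_norm)
  also have "\<dots> \<le> norm (P y) * (cos_min_angle W\<^sub>1 W\<^sub>2 * norm y)"
    using inner_le_cos_min_angle[OF assms(1,2) Py assms(4)] by (simp add: mult_ac)
  finally show ?thesis using False by simp
qed

lemma subspace_set_plus:
  assumes "subspace W\<^sub>1" "subspace W\<^sub>2"
  shows "subspace (W\<^sub>1 + W\<^sub>2)"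
proof -
  have "W\<^sub>1 + W\<^sub>2 = {x + y |x y. x \<in> W\<^sub>1 \<and> y \<in> W\<^sub>2}" unfolding set_plus_def by blast
  then show ?thesis using subspace_sums[OF assms] by simp
qed

text \<open>The equations \<open>ab\<close> are the two rows of the system for
  \<open>R\<^sub>1\<close>. Solved for \<open>A x\<close> and \<open>B x\<close>, they show
  membership in \<open>W\<^sub>1\<close> and \<open>W\<^sub>2\<close>.\<close>

lemma is_orthogonal_projection_set_plus:
  fixes P\<^sub>1 P\<^sub>2 Q :: "'a::real_inner \<Rightarrow>\<^sub>L 'a"
  assumes P: "is_orthogonal_projection W\<^sub>1 P\<^sub>1" "is_orthogonal_projection W\<^sub>2 P\<^sub>2"
    and ab: "\<And>x. A x + P\<^sub>1 (B x) = P\<^sub>1 x" "\<And>x. P\<^sub>2 (A x) + B x = P\<^sub>2 x"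
    and Q: "\<And>x. Q x = A x + B x"
  shows "is_orthogonal_projection (W\<^sub>1 + W\<^sub>2) Q"
  unfolding is_orthogonal_projection_def
proof (intro allI conjI)
  fix x
  have A_eq: "A x = P\<^sub>1 (x - B x)" using ab(1)[of x] by (simp add: blinfun.diff_right algebra_simps)
  have B_eq: "B x = P\<^sub>2 (x - A x)" using ab(2)[of x] by (simp add: blinfun.diff_right algebra_simps)
  have A_in: "A x \<in> W\<^sub>1" using P(1) by (simp add: A_eq is_orthogonal_projection_def)
  have B_in: "B x \<in> W\<^sub>2" using P(2) by (simp add: B_eq is_orthogonal_projection_def)
  show "Q x \<in> W\<^sub>1 + W\<^sub>2" unfolding Q using A_in B_in by (rule set_plus_intro)
  \<comment> \<open>The same vector \<open>x - Q x\<close> is the residual of projecting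
    \<open>x - B x\<close> onto \<open>W\<^sub>1\<close> and, below, of projecting
    \<open>x - A x\<close> onto \<open>W\<^sub>2\<close>. It is therefore orthogonal to
    both.\<close>
  have eq\<^sub>1: "x - Q x = (x - B x) - P\<^sub>1 (x - B x)" unfolding Q A_eq[symmetric] by simp
  have "x - Q x \<in> W\<^sub>1\<^sup>\<bottom>"
    unfolding eq\<^sub>1 using P(1) by (simp add: is_orthogonal_projection_def)
  have eq\<^sub>2: "x - Q x = (x - A x) - P\<^sub>2 (x - A x)" unfolding Q B_eq[symmetric] by simp
  have "x - Q x \<in> W\<^sub>2\<^sup>\<bottom>"
    unfolding eq\<^sub>2 using P(2) by (simp add: is_orthogonal_projection_def)
  with \<open>x - Q x \<in> W\<^sub>1\<^sup>\<bottom>\<close> show "x - Q x \<in> (W\<^sub>1 + W\<^sub>2)\<^sup>\<bottom>"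
    by (auto simp: orthogonal_comp_def orthogonal_def set_plus_def inner_add_left)
qed

lemma R1_operator_inverse:
  fixes W\<^sub>1 W\<^sub>2 :: "'a::{real_inner, complete_space} set"
  assumes W: "subspace W\<^sub>1" "closed W\<^sub>1" "subspace W\<^sub>2" "closed W\<^sub>2"
    and c: "cos_min_angle W\<^sub>1 W\<^sub>2 < 1"
  obtains S where "R1_operator W\<^sub>1 W\<^sub>2 o\<^sub>L S = id_blinfun" "S o\<^sub>L R1_operator W\<^sub>1 W\<^sub>2 = id_blinfun"
    "norm S \<le> 2 / (1 - cos_min_angle W\<^sub>1 W\<^sub>2)"
proof -
  let ?P\<^sub>1 = "orthogonal_projection W\<^sub>1" and ?P\<^sub>2 = "orthogonal_projection W\<^sub>2"
  let ?c = "cos_min_angle W\<^sub>1 W\<^sub>2"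
  note P\<^sub>1 = is_orthogonal_projection_orthogonal_projection[OF W(1,2)]
  note P\<^sub>2 = is_orthogonal_projection_orthogonal_projection[OF W(3,4)]
  define K where "K = blinfun_column (blinfun_row 0 ?P\<^sub>1) (blinfun_row ?P\<^sub>2 0)"
  have K: "K (x, y) = (?P\<^sub>1 y, ?P\<^sub>2 x)" for x y by (simp add: K_def)
  have R: "R1_operator W\<^sub>1 W\<^sub>2 = id_blinfun + K"
    by (rule blinfun_eqI) (simp add: R1_operator_def K_def blinfun.add_left prod_eq_iff)
  \<comment> \<open>The factor \<open>r\<close> is kept general: it is the cosine on
    \<open>W\<^sub>1 \<times> W\<^sub>2\<close> and 1 on the whole space. The swap of coordinates
    does not affect the product norm.\<close>
  have K_norm: "norm (K (x, y)) \<le> r * norm (x, y)"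
    if "norm (?P\<^sub>1 y) \<le> r * norm y" "norm (?P\<^sub>2 x) \<le> r * norm x" "0 \<le> r" for x y r
  proof -
    have "norm (K (x, y)) = sqrt ((norm (?P\<^sub>1 y))\<^sup>2 + (norm (?P\<^sub>2 x))\<^sup>2)" by (simp add: K norm_Pair)
    also have "\<dots> \<le> sqrt ((r * norm y)\<^sup>2 + (r * norm x)\<^sup>2)"
      using that by (intro real_sqrt_le_mono add_mono power_mono) auto
    also have "\<dots> = sqrt (r\<^sup>2 * ((norm x)\<^sup>2 + (norm y)\<^sup>2))"
      by (simp add: power_mult_distrib algebra_simps)
    also have "\<dots> = r * norm (x, y)"
      using that(3) by (simp add: norm_Pair real_sqrt_mult)
    finally show ?thesis .
  qed
  show thesis
  proof (rule id_plus_subspace_contraction_inverse[of "W\<^sub>1 \<times> W\<^sub>2" K ?c])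
    show "subspace (W\<^sub>1 \<times> W\<^sub>2)" by (rule subspace_Times[OF W(1,3)])
    show "closed (W\<^sub>1 \<times> W\<^sub>2)" by (rule closed_Times[OF W(2,4)])
    show "K z \<in> W\<^sub>1 \<times> W\<^sub>2" for z
      using P\<^sub>1 P\<^sub>2 by (cases z) (simp add: K is_orthogonal_projection_def)
    show "0 \<le> ?c" by (rule cos_min_angle_nonneg[OF W(1,3)])
    \<comment> \<open>Because \<open>K\<close> swaps the coordinates, each projection acts on a
      vector of the other subspace, which is where the angle enters.\<close>
    then show "norm (K z) \<le> ?c * norm z" if "z \<in> W\<^sub>1 \<times> W\<^sub>2" for z
      using that projection_le_cos_min_angle[OF W(1,3) P\<^sub>1]
        projection_le_cos_min_angle[OF W(3,1) P\<^sub>2]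
      by (cases z) (auto intro!: K_norm simp: cos_min_angle_commute[of W\<^sub>2])
    show "norm (K z) \<le> norm z" for z
      using K_norm[of "snd z" 1 "fst z"] is_orthogonal_projection_norm_le[OF P\<^sub>1]
        is_orthogonal_projection_norm_le[OF P\<^sub>2] by simp
  qed (use c that in \<open>simp_all add: R\<close>)
qed

theorem theorem5p5:
  fixes W\<^sub>1 W\<^sub>2 :: "'a::{real_inner, complete_space} set"
  assumes "subspace W\<^sub>1" and "closed W\<^sub>1"
    and "subspace W\<^sub>2" and "closed W\<^sub>2"
    and "cos_min_angle W\<^sub>1 W\<^sub>2 < 1"
  shows "\<exists>R\<^sub>1_inv :: ('a \<times> 'a) \<Rightarrow>\<^sub>L ('a \<times> 'a).
           R1_operator W\<^sub>1 W\<^sub>2 o\<^sub>L R\<^sub>1_inv = id_blinfun \<and>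
           R\<^sub>1_inv o\<^sub>L R1_operator W\<^sub>1 W\<^sub>2 = id_blinfun \<and>
           norm R\<^sub>1_inv \<le> 4 / (1 - cos_min_angle W\<^sub>1 W\<^sub>2) \<and>
           closed (W\<^sub>1 + W\<^sub>2) \<and>
           orthogonal_projection (W\<^sub>1 + W\<^sub>2) =
             blinfun_row id_blinfun id_blinfun o\<^sub>L R\<^sub>1_inv o\<^sub>L
               blinfun_column (orthogonal_projection W\<^sub>1) (orthogonal_projection W\<^sub>2)"
proof -
  let ?P\<^sub>1 = "orthogonal_projection W\<^sub>1" and ?P\<^sub>2 = "orthogonal_projection W\<^sub>2"
  note P\<^sub>1 = is_orthogonal_projection_orthogonal_projection[OF assms(1,2)]
  note P\<^sub>2 = is_orthogonal_projection_orthogonal_projection[OF assms(3,4)]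
  obtain S where S: "R1_operator W\<^sub>1 W\<^sub>2 o\<^sub>L S = id_blinfun" "S o\<^sub>L R1_operator W\<^sub>1 W\<^sub>2 = id_blinfun"
    and S_norm: "norm S \<le> 2 / (1 - cos_min_angle W\<^sub>1 W\<^sub>2)"
    using R1_operator_inverse[OF assms] by blast
  define Q where "Q = blinfun_row id_blinfun id_blinfun o\<^sub>L S o\<^sub>L blinfun_column ?P\<^sub>1 ?P\<^sub>2"
  define A where "A x = fst (S (?P\<^sub>1 x, ?P\<^sub>2 x))" for x
  define B where "B x = snd (S (?P\<^sub>1 x, ?P\<^sub>2 x))" for x
  have "R1_operator W\<^sub>1 W\<^sub>2 (S w) = w" for w 
    using S(1) by (metis blinfun_apply_blinfun_compose blinfun_apply_id_blinfun id_apply)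
  from this[of "(?P\<^sub>1 x, ?P\<^sub>2 x)" for x]
  have AB: "A x + ?P\<^sub>1 (B x) = ?P\<^sub>1 x" "?P\<^sub>2 (A x) + B x = ?P\<^sub>2 x" for x
    by (simp_all add: R1_operator_def A_def B_def)
  have sub: "subspace (W\<^sub>1 + W\<^sub>2)" by (rule subspace_set_plus[OF assms(1,3)])
  have Q: "is_orthogonal_projection (W\<^sub>1 + W\<^sub>2) Q"
    by (rule is_orthogonal_projection_set_plus[OF P\<^sub>1 P\<^sub>2 AB])
      (simp add: Q_def A_def B_def)
  \<comment> \<open>Closedness is derived from \<open>Q\<close> first;
    \<open>orthogonal_projection_eqI\<close> requires it in order to identify the definite
    description with \<open>Q\<close>.\<close>
  have cl: "closed (W\<^sub>1 + W\<^sub>2)" by (rule is_orthogonal_projection_closed[OF sub Q])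
  \<comment> \<open>The fixed point argument gives the constant 2, half of the stated one.\<close>
  have "2 / (1 - cos_min_angle W\<^sub>1 W\<^sub>2) \<le> 4 / (1 - cos_min_angle W\<^sub>1 W\<^sub>2)"
    using assms(5) by (intro divide_right_mono) auto
  with S_norm have "norm S \<le> 4 / (1 - cos_min_angle W\<^sub>1 W\<^sub>2)" by linarith
  with S cl orthogonal_projection_eqI[OF sub cl Q] show ?thesis unfolding Q_def by blast
qed

end
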